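(* Let $k$ be $\mathbb{Z}$ or $\mathbb{R}$, and let $A$ be a pm-ring equipped with a $k$-algebra structure. Then the spectral fundamental group $\pi_{k}^{alg}(A)$ is an abelian group.
   Context: All rings are commutative with unity. A pm-ring is a ring in which every prime ideal is contained in a unique maximal ideal. $\mathrm{Spec}(A)$ carries the Zariski topology and $\mathrm{Max}(A)$ the subspace topology; for a pm-ring $A$ let $\mu:\mathrm{Spec}(A)\to\mathrm{Max}(A)$ send each prime to the unique maximal ideal containing it (this is a continuous retraction, and $\mathrm{Max}(A)$ is compact Hausdorff). Let $k$ be $\mathbb{Z}$ or $\mathbb{R}$. $E_k(A)$ is the monoid of unital $k$-algebra endomorphisms of $A$. For $f\in E_k(A)$, the induced spectral map $\mu_f:\mathrm{Max}(A)\to\mathrm{Max}(A)$ is the continuous map $\mu_f(M)=\mu(f^{-1}(M))$. Put $X_k^A=\{\mu_f : f\in E_k(A)\}$, with the subspace topology from the space $C(\mathrm{Max}(A),\mathrm{Max}(A))$ of continuous self-maps with the compact-open topology. The spectral fundamental group of $A$ is $\pi_k^{alg}(A):=\pi_1(X_k^A,\mu_{id_A})$, i.e. based-homotopy classes of loops in $X_k^A$ at $\mu_{id_A}$ (the identity map of $\mathrm{Max}(A)$), with the operation induced by concatenation. *)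

theory Defs
  imports "HOL-Analysis.Analysis" "HOL-Algebra.Algebra" "HOL-Algebra.Algebraic_Closure_Type"
begin

definition Spec :: "('a, 'b) ring_scheme \<Rightarrow> 'a set set" where
  "Spec A = {P. primeideal P A}"

definition Max_Spec :: "('a, 'b) ring_scheme \<Rightarrow> 'a set set" where
  "Max_Spec A = {M. maximalideal M A}"

definition vanishing :: "('a, 'b) ring_scheme \<Rightarrow> 'a set \<Rightarrow> 'a set set" where
  "vanishing A E = {P \<in> Spec A. E \<subseteq> P}"

definition zariski :: "('a, 'b) ring_scheme \<Rightarrow> 'a set topology" where
  "zariski A = topology (\<lambda>U. \<exists>E. E \<subseteq> carrier A \<and> U = Spec A - vanishing A E)"

definition max_topology :: "('a, 'b) ring_scheme \<Rightarrow> 'a set topology" where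
  "max_topology A = subtopology (zariski A) (Max_Spec A)"

lemma istopology_zariski:
  "istopology (\<lambda>U. \<exists>E. E \<subseteq> carrier A \<and> U = Spec A - vanishing A E)"
  unfolding istopology_def
proof (intro conjI allI impI; (elim exE conjE)?)
  fix U V E F
  assume E: "E \<subseteq> carrier A" "U = Spec A - vanishing A E"
    and F: "F \<subseteq> carrier A" "V = Spec A - vanishing A F"
  define G where "G = {a \<otimes>\<^bsub>A\<^esub> b | a b. a \<in> E \<and> b \<in> F}"
  have iff: "G \<subseteq> P \<longleftrightarrow> E \<subseteq> P \<or> F \<subseteq> P" if "primeideal P A" for P
  proof -
    interpret primeideal P A by (rule that)
    show ?thesis
      unfolding G_def using E(1) F(1) I_prime I_l_closed I_r_closed by blast
  qed
  show "\<exists>G. G \<subseteq> carrier A \<and> U \<inter> V = Spec A - vanishing A G"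
  proof (cases "Spec A = {}")
    case True
    then show ?thesis using E F by auto
  next
    case False
    then obtain P where "primeideal P A" by (auto simp: Spec_def)
    then interpret primeideal P A .
    have "G \<subseteq> carrier A" unfolding G_def using E(1) F(1) by auto
    moreover have "U \<inter> V = Spec A - vanishing A G"
      using iff unfolding E(2) F(2) vanishing_def Spec_def by blast
    ultimately show ?thesis by blast
  qed
next
  fix \<K>
  assume "\<forall>U\<in>\<K>. \<exists>E. E \<subseteq> carrier A \<and> U = Spec A - vanishing A E"
  then obtain E where E: "\<And>U. U \<in> \<K> \<Longrightarrow> E U \<subseteq> carrier A \<and> U = Spec A - vanishing A (E U)"
    by metis
  have "\<Union>\<K> = Spec A - vanishing A (\<Union>U\<in>\<K>. E U)"
    using E unfolding vanishing_def by blast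
  moreover have "(\<Union>U\<in>\<K>. E U) \<subseteq> carrier A"
    using E by blast
  ultimately show "\<exists>E. E \<subseteq> carrier A \<and> \<Union>\<K> = Spec A - vanishing A E"
    by blast
qed

lemma openin_zariski:
  "openin (zariski A) U \<longleftrightarrow> (\<exists>E. E \<subseteq> carrier A \<and> U = Spec A - vanishing A E)"
  unfolding zariski_def by (simp add: topology_inverse'[OF istopology_zariski])

lemma topspace_zariski: "topspace (zariski A) = Spec A"
proof -
  have "vanishing A (carrier A) = {}"
    unfolding vanishing_def Spec_def
    using primeideal.I_notcarr ideal.Icarr primeideal.axioms(1) by fastforce
  then have "openin (zariski A) (Spec A)"
    unfolding openin_zariski by (intro exI[of _ "carrier A"]) auto
  moreover have "U \<subseteq> Spec A" if "openin (zariski A) U" for U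
    using that unfolding openin_zariski by blast
  ultimately show ?thesis
    by (meson openin_subset openin_topspace subset_antisym)
qed

locale pm_ring = cring +
  assumes unique_maximal: "primeideal P R \<Longrightarrow> \<exists>!M. maximalideal M R \<and> P \<subseteq> M"

definition pm_retraction :: "('a, 'b) ring_scheme \<Rightarrow> 'a set \<Rightarrow> 'a set" where
  "pm_retraction A P = (THE M. maximalideal M A \<and> P \<subseteq> M)"

text \<open>Functions are extensional, so that equality of functions in the space means
  equality on \<^term>\<open>topspace S\<close>.\<close>

definition continuous_maps :: "'a topology \<Rightarrow> 'b topology \<Rightarrow> ('a \<Rightarrow> 'b) set" where
  "continuous_maps S T = {f \<in> extensional (topspace S). continuous_map S T f}"

definition compact_open_topology :: "'a topology \<Rightarrow> 'b topology \<Rightarrow> ('a \<Rightarrow> 'b) topology" where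
  "compact_open_topology S T =
     topology_generated_by
       {{f \<in> continuous_maps S T. f ` K \<subseteq> U} | K U. compactin S K \<and> openin T U}"

lemma topspace_compact_open_topology:
  "topspace (compact_open_topology S T) = continuous_maps S T"
proof -
  have "continuous_maps S T \<in>
      {{f \<in> continuous_maps S T. f ` K \<subseteq> U} | K U. compactin S K \<and> openin T U}"
    by (rule CollectI, intro exI[of _ "{}"]) auto
  then show ?thesis
    unfolding compact_open_topology_def topology_generated_by_topspace by blast
qed

definition loops :: "'a topology \<Rightarrow> 'a \<Rightarrow> (real \<Rightarrow> 'a) set" where
  "loops S x = {p. pathin S p \<and> p 0 = x \<and> p 1 = x}"

definition loop_homotopy :: "'a topology \<Rightarrow> 'a \<Rightarrow> ((real \<Rightarrow> 'a) \<times> (real \<Rightarrow> 'a)) set" where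
  "loop_homotopy S x = {(p, q). p \<in> loops S x \<and> q \<in> loops S x \<and>
     homotopic_with (\<lambda>r. r 0 = x \<and> r 1 = x) (top_of_set {0..1}) S p q}"

definition loop_concat :: "(real \<Rightarrow> 'a) \<Rightarrow> (real \<Rightarrow> 'a) \<Rightarrow> real \<Rightarrow> 'a" where
  "loop_concat p q = (\<lambda>t. if t \<le> 1/2 then p (2 * t) else q (2 * t - 1))"

definition fundamental_group :: "'a topology \<Rightarrow> 'a \<Rightarrow> (real \<Rightarrow> 'a) set monoid" where
  "fundamental_group S x =
     \<lparr>carrier = loops S x // loop_homotopy S x,
      mult = (\<lambda>C D. \<Union>p\<in>C. \<Union>q\<in>D. loop_homotopy S x `` {loop_concat p q}),
      one = loop_homotopy S x `` {\<lambda>t. x}\<rparr>"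

definition algebra_endomorphisms ::
    "('k, 'l) ring_scheme \<Rightarrow> ('k, 'a, 'b) module_scheme \<Rightarrow> ('a \<Rightarrow> 'a) set" where
  "algebra_endomorphisms K A =
     {f \<in> ring_hom A A. \<forall>c\<in>carrier K. \<forall>x\<in>carrier A. f (c \<odot>\<^bsub>A\<^esub> x) = c \<odot>\<^bsub>A\<^esub> f x}"

definition spectral_map :: "('a, 'b) ring_scheme \<Rightarrow> ('a \<Rightarrow> 'a) \<Rightarrow> 'a set \<Rightarrow> 'a set" where
  "spectral_map A f = (\<lambda>M\<in>Max_Spec A. pm_retraction A {x \<in> carrier A. f x \<in> M})"

definition spectral_space ::
    "('k, 'l) ring_scheme \<Rightarrow> ('k, 'a, 'b) module_scheme \<Rightarrow> ('a set \<Rightarrow> 'a set) topology" where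
  "spectral_space K A =
     subtopology (compact_open_topology (max_topology A) (max_topology A))
       (spectral_map A ` algebra_endomorphisms K A)"

definition spectral_fundamental_group ::
    "('k, 'l) ring_scheme \<Rightarrow> ('k, 'a, 'b) module_scheme \<Rightarrow> (real \<Rightarrow> 'a set \<Rightarrow> 'a set) set monoid" where
  "spectral_fundamental_group K A =
     fundamental_group (spectral_space K A) (spectral_map A (\<lambda>x. x))"

end

theory Submission
  imports Defs
begin

text \<open>The reason for commutativity is the Eckmann--Hilton argument: the space \<open>X\<close> of spectral maps is a
  topological monoid under composition, and its unit \<open>\<mu>\<^sub>i\<^sub>d\<close> is the base point.

  In a topological monoid, loops at the unit can be multiplied pointwise. Stretching \<open>p\<close> over the
  first half of the interval and \<open>q\<close> over the second, with both resting at the unit in the other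
  half, changes neither homotopy class; the pointwise product of the two stretched loops is the
  concatenation of \<open>p\<close> and \<open>q\<close>, whichever factor is written first, because at each time one of them
  is the unit. So the concatenation is homotopic both to \<open>p \<cdot> q\<close> and to \<open>q \<cdot> p\<close>
  (\<open>loop_mult_homotopic_concat\<close>). Consequently the operation on homotopy classes is induced by the
  pointwise product, which is strictly associative and unital, and it is commutative. Inverses
  come from reversing a loop. All homotopies are built from reparametrizations
  (\<open>loop_homotopy_reparametrization\<close>).

  Two points make \<open>X\<close> a topological monoid. It is closed under composition because
  \<open>\<mu>\<^sub>g\<^sub>\<circ>\<^sub>f = \<mu>\<^sub>f \<circ> \<mu>\<^sub>g\<close>: both sides send \<open>M\<close> to a maximal ideal above the prime \<open>(g \<circ> f)\<^sup>-\<^sup>1(M)\<close>, and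
  there is only one (\<open>spectral_map_compose\<close>). And composition is jointly continuous for the
  compact-open topology because the space in the middle, \<open>Max(A)\<close>, is locally compact
  Hausdorff (\<open>continuous_map_composition\<close>); in fact it is compact for every commutative ring, and
  Hausdorff for a pm-ring since two distinct maximal ideals contain no common prime. Over any \<open>k\<close>
  the \<open>k\<close>-algebra endomorphisms contain the identity and are closed under composition, so one
  argument covers both cases.\<close>

section \<open>Loops in a topological space\<close>

lemma equiv_loop_homotopy: "equiv (loops S x) (loop_homotopy S x)"
proof (rule equivI)
  show "loop_homotopy S x \<subseteq> loops S x \<times> loops S x"
    by (auto simp: loop_homotopy_def)
  show "refl_on (loops S x) (loop_homotopy S x)"
    by (auto simp: refl_on_def loop_homotopy_def loops_def pathin_def)
  show "sym (loop_homotopy S x)"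
    by (auto simp: sym_def loop_homotopy_def intro: homotopic_with_symD)
  show "trans (loop_homotopy S x)"
    by (auto simp: trans_def loop_homotopy_def intro: homotopic_with_trans)
qed

lemma loop_homotopy_refl: "p \<in> loops S x \<Longrightarrow> (p, p) \<in> loop_homotopy S x"
  using equiv_loop_homotopy[of S x] by (auto simp: equiv_def refl_on_def)

lemma loop_homotopy_sym: "(p, q) \<in> loop_homotopy S x \<Longrightarrow> (q, p) \<in> loop_homotopy S x"
  using equiv_loop_homotopy[of S x] by (auto simp: equiv_def sym_def)

lemma loop_homotopy_trans:
  "(p, q) \<in> loop_homotopy S x \<Longrightarrow> (q, r) \<in> loop_homotopy S x \<Longrightarrow> (p, r) \<in> loop_homotopy S x"
  using equiv_loop_homotopy[of S x] by (auto simp: equiv_def trans_def)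

lemma loops_cong:
  assumes "p \<in> loops S x" "\<And>t. t \<in> {0..1} \<Longrightarrow> p t = q t"
  shows "q \<in> loops S x"
  using assms unfolding loops_def pathin_def
  by (auto intro: continuous_map_eq[of "top_of_set {0..1}" S p q])

lemma loop_homotopy_cong:
  assumes "p \<in> loops S x" "\<And>t. t \<in> {0..1} \<Longrightarrow> p t = q t"
  shows "(p, q) \<in> loop_homotopy S x"
proof -
  have "q \<in> loops S x"
    by (rule loops_cong[OF assms])
  with assms show ?thesis
    unfolding loop_homotopy_def
    by (auto simp: loops_def pathin_def intro!: homotopic_with_equal)
qed

lemma loop_reparametrization:
  assumes p: "p \<in> loops S x"
    and \<phi>: "continuous_on {0..1} \<phi>" "\<phi> ` {0..1} \<subseteq> {0..1}" "\<phi> 0 \<in> {0, 1}" "\<phi> 1 \<in> {0, 1}"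
  shows "p \<circ> \<phi> \<in> loops S x"
proof -
  have "continuous_map (top_of_set {0..1}) (top_of_set {0..1}) \<phi>"
    using \<phi> by (auto simp: continuous_map_in_subtopology)
  then have "continuous_map (top_of_set {0..1}) S (p \<circ> \<phi>)"
    by (rule continuous_map_compose) (use p in \<open>simp add: loops_def pathin_def\<close>)
  then show ?thesis
    using p \<phi>(3,4) by (auto simp: loops_def pathin_def)
qed

text \<open>The unit interval is convex, so \<open>\<phi>\<close> and \<open>\<psi>\<close> are joined by straight lines, which stay fixed at the
  two end points. Allowing \<open>\<phi>\<close> to end at either 0 or 1 covers both the delay of a loop and the path
  that runs along a loop and back.\<close>

lemma loop_homotopy_reparametrization:
  assumes p: "p \<in> loops S x"
    and \<phi>: "continuous_on {0..1} \<phi>" "\<phi> ` {0..1} \<subseteq> {0..1}" "\<phi> 0 \<in> {0, 1}" "\<phi> 1 \<in> {0, 1}"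
    and \<psi>: "continuous_on {0..1} \<psi>" "\<psi> ` {0..1} \<subseteq> {0..1}" "\<psi> 0 = \<phi> 0" "\<psi> 1 = \<phi> 1"
  shows "(p \<circ> \<phi>, p \<circ> \<psi>) \<in> loop_homotopy S x"
proof -
  define k where "k = (\<lambda>z::real \<times> real. (1 - fst z) * \<phi> (snd z) + fst z * \<psi> (snd z))"
  have "continuous_on ({0..1} \<times> {0..1}) k"
    unfolding k_def
    by (intro continuous_intros continuous_on_compose2[OF \<phi>(1)] continuous_on_compose2[OF \<psi>(1)])
       auto
  moreover have "k z \<in> {0..1}" if "z \<in> {0..1} \<times> {0..1}" for z
  proof -
    have "convex {0..1::real}" by simp
    moreover have "\<phi> (snd z) \<in> {0..1}" "\<psi> (snd z) \<in> {0..1}" "fst z \<in> {0..1}"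
      using that \<phi>(2) \<psi>(2) by auto
    ultimately show ?thesis
      unfolding k_def convex_alt by (metis atLeastAtMost_iff real_scaleR_def)
  qed
  ultimately have "continuous_map (prod_topology (top_of_set {0..1}) (top_of_set {0..1}))
      (top_of_set {0..1}) k"
    by (auto simp: prod_topology_subtopology subtopology_subtopology Times_Int_Times
        continuous_map_in_subtopology simp flip: euclidean_product_topology)
  then have "continuous_map (prod_topology (top_of_set {0..1}) (top_of_set {0..1})) S (p \<circ> k)"
    by (rule continuous_map_compose) (use p in \<open>simp add: loops_def pathin_def\<close>)
  moreover have "k (s, 0) = \<phi> 0" "k (s, 1) = \<phi> 1" for s
    by (simp_all add: k_def \<psi>(3,4) algebra_simps)
  then have "p (k (s, 0)) = x" "p (k (s, 1)) = x" for s
    using p \<phi>(3,4) by (auto simp: loops_def)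
  ultimately have "homotopic_with (\<lambda>r. r 0 = x \<and> r 1 = x) (top_of_set {0..1}) S (p \<circ> \<phi>) (p \<circ> \<psi>)"
    unfolding homotopic_with_def by (intro exI[of _ "p \<circ> k"]) (auto simp: k_def)
  then show ?thesis
    using loop_reparametrization[OF p \<phi>] loop_reparametrization[OF p \<psi>(1,2)] \<phi>(3,4) \<psi>(3,4)
    by (auto simp: loop_homotopy_def)
qed

lemma loop_homotopy_contract:
  assumes p: "p \<in> loops S x"
    and \<phi>: "continuous_on {0..1} \<phi>" "\<phi> ` {0..1} \<subseteq> {0..1}" "\<phi> 0 = 0" "\<phi> 1 = 0"
  shows "(p \<circ> \<phi>, \<lambda>t. x) \<in> loop_homotopy S x"
proof -
  have "(p \<circ> \<phi>, p \<circ> (\<lambda>t. 0)) \<in> loop_homotopy S x"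
    by (rule loop_homotopy_reparametrization[OF p]) (use \<phi> in auto)
  then show ?thesis
    using p by (simp add: loops_def o_def)
qed

lemma loop_homotopy_reparametrization_id:
  assumes p: "p \<in> loops S x"
    and \<phi>: "continuous_on {0..1} \<phi>" "\<phi> ` {0..1} \<subseteq> {0..1}" "\<phi> 0 = 0" "\<phi> 1 = 1"
  shows "(p \<circ> \<phi>, p) \<in> loop_homotopy S x"
proof -
  have "(p \<circ> \<phi>, p \<circ> (\<lambda>t. t)) \<in> loop_homotopy S x"
    by (rule loop_homotopy_reparametrization[OF p]) (use \<phi> in auto)
  then show ?thesis
    by (simp add: o_def)
qed

section \<open>The fundamental group of a topological monoid\<close>

text \<open>The equations are required only on the underlying space, since composition of extensional
  functions satisfies them only there.\<close>

locale topological_monoid =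
  fixes S :: "'a topology" and m :: "'a \<Rightarrow> 'a \<Rightarrow> 'a" and e :: 'a
  assumes unit_in: "e \<in> topspace S"
    and mult_continuous: "continuous_map (prod_topology S S) S (\<lambda>(x, y). m x y)"
    and mult_assoc: "\<lbrakk>x \<in> topspace S; y \<in> topspace S; z \<in> topspace S\<rbrakk> \<Longrightarrow> m (m x y) z = m x (m y z)"
    and left_unit: "x \<in> topspace S \<Longrightarrow> m e x = x"
    and right_unit: "x \<in> topspace S \<Longrightarrow> m x e = x"
begin

definition loop_mult :: "(real \<Rightarrow> 'a) \<Rightarrow> (real \<Rightarrow> 'a) \<Rightarrow> real \<Rightarrow> 'a" where
  "loop_mult p q = (\<lambda>t. m (p t) (q t))"

lemma loop_in_space: "p \<in> loops S e \<Longrightarrow> t \<in> {0..1} \<Longrightarrow> p t \<in> topspace S"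
  by (auto simp: loops_def pathin_def continuous_map_def Pi_iff)

lemma continuous_map_mult:
  assumes "continuous_map Z S f" "continuous_map Z S g"
  shows "continuous_map Z S (\<lambda>z. m (f z) (g z))"
  using continuous_map_compose[OF continuous_map_pairedI[OF assms] mult_continuous]
  by (simp add: o_def)

lemma loop_mult_in_loops: "p \<in> loops S e \<Longrightarrow> q \<in> loops S e \<Longrightarrow> loop_mult p q \<in> loops S e"
  unfolding loops_def pathin_def loop_mult_def
  by (auto intro: continuous_map_mult simp: left_unit unit_in)

lemma loop_mult_homotopy:
  assumes "(p, p') \<in> loop_homotopy S e" "(q, q') \<in> loop_homotopy S e"
  shows "(loop_mult p q, loop_mult p' q') \<in> loop_homotopy S e"
proof -
  let ?I = "top_of_set {0..1::real}"
  obtain h where h: "continuous_map (prod_topology ?I ?I) S h"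
      "\<And>t. h (0, t) = p t" "\<And>t. h (1, t) = p' t" "\<And>s. s \<in> {0..1} \<Longrightarrow> h (s, 0) = e \<and> h (s, 1) = e"
    using assms(1) by (auto simp: loop_homotopy_def homotopic_with_def)
  obtain k where k: "continuous_map (prod_topology ?I ?I) S k"
      "\<And>t. k (0, t) = q t" "\<And>t. k (1, t) = q' t" "\<And>s. s \<in> {0..1} \<Longrightarrow> k (s, 0) = e \<and> k (s, 1) = e"
    using assms(2) by (auto simp: loop_homotopy_def homotopic_with_def)
  have "homotopic_with (\<lambda>r. r 0 = e \<and> r 1 = e) ?I S (loop_mult p q) (loop_mult p' q')"
    unfolding homotopic_with_def
    by (intro exI[of _ "\<lambda>z. m (h z) (k z)"])
       (use h k in \<open>auto simp: loop_mult_def left_unit unit_in intro: continuous_map_mult\<close>)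
  then show ?thesis
    using assms by (auto simp: loop_homotopy_def loop_mult_in_loops)
qed

lemma const_loop: "(\<lambda>t. e) \<in> loops S e"
  by (simp add: loops_def unit_in)

text \<open>At every time one of the two stretched loops rests at the unit, which is why the order of the
  factors does not matter.\<close>

lemma loop_concat_eq_mult:
  assumes p: "p \<in> loops S e" and q: "q \<in> loops S e" and t: "t \<in> {0..1}"
  shows "loop_mult (p \<circ> (\<lambda>t. min 1 (2 * t))) (q \<circ> (\<lambda>t. max 0 (2 * t - 1))) t = loop_concat p q t"
    and "loop_mult (q \<circ> (\<lambda>t. max 0 (2 * t - 1))) (p \<circ> (\<lambda>t. min 1 (2 * t))) t = loop_concat p q t"
proof -
  have *: "p 1 = e" "q 0 = e"
    using p q by (auto simp: loops_def)
  show "loop_mult (p \<circ> (\<lambda>t. min 1 (2 * t))) (q \<circ> (\<lambda>t. max 0 (2 * t - 1))) t = loop_concat p q t"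
    and "loop_mult (q \<circ> (\<lambda>t. max 0 (2 * t - 1))) (p \<circ> (\<lambda>t. min 1 (2 * t))) t = loop_concat p q t"
  proof (atomize (full), cases "t \<le> 1/2")
    case True
    then have "min 1 (2 * t) = 2 * t" "max 0 (2 * t - 1) = 0" "p (2 * t) \<in> topspace S"
      using t by (auto intro: loop_in_space[OF p])
    then show "loop_mult (p \<circ> (\<lambda>t. min 1 (2 * t))) (q \<circ> (\<lambda>t. max 0 (2 * t - 1))) t = loop_concat p q t
        \<and> loop_mult (q \<circ> (\<lambda>t. max 0 (2 * t - 1))) (p \<circ> (\<lambda>t. min 1 (2 * t))) t = loop_concat p q t"
      using True * by (simp add: loop_mult_def loop_concat_def left_unit right_unit)
  next
    case False
    then have "min 1 (2 * t) = 1" "max 0 (2 * t - 1) = 2 * t - 1" "q (2 * t - 1) \<in> topspace S"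
      using t by (auto intro: loop_in_space[OF q])
    then show "loop_mult (p \<circ> (\<lambda>t. min 1 (2 * t))) (q \<circ> (\<lambda>t. max 0 (2 * t - 1))) t = loop_concat p q t
        \<and> loop_mult (q \<circ> (\<lambda>t. max 0 (2 * t - 1))) (p \<circ> (\<lambda>t. min 1 (2 * t))) t = loop_concat p q t"
      using False * by (simp add: loop_mult_def loop_concat_def left_unit right_unit)
  qed
qed

lemma first_half_homotopy:
  assumes "p \<in> loops S e"
  shows "(p \<circ> (\<lambda>t. min 1 (2 * t)), p) \<in> loop_homotopy S e"
  by (rule loop_homotopy_reparametrization_id[OF assms]) (auto intro!: continuous_intros)

lemma second_half_homotopy:
  assumes "p \<in> loops S e"
  shows "(p \<circ> (\<lambda>t. max 0 (2 * t - 1)), p) \<in> loop_homotopy S e"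
  by (rule loop_homotopy_reparametrization_id[OF assms]) (auto intro!: continuous_intros)

text \<open>
  Stretching a loop does not change its class, and pointwise multiplication respects homotopy;
  so the two ways of writing the concatenation as a product give the two homotopies.\<close>

lemma loop_mult_homotopic_concat:
  assumes p: "p \<in> loops S e" and q: "q \<in> loops S e"
  shows "(loop_concat p q, loop_mult p q) \<in> loop_homotopy S e"
    and "(loop_concat p q, loop_mult q p) \<in> loop_homotopy S e"
proof -
  let ?p = "p \<circ> (\<lambda>t. min 1 (2 * t))" and ?q = "q \<circ> (\<lambda>t. max 0 (2 * t - 1))"
  have hom: "(?p, p) \<in> loop_homotopy S e" "(?q, q) \<in> loop_homotopy S e"
    by (rule first_half_homotopy[OF p], rule second_half_homotopy[OF q])
  then have "?p \<in> loops S e" "?q \<in> loops S e"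
    by (auto simp: loop_homotopy_def)
  then have "(loop_mult ?p ?q, loop_concat p q) \<in> loop_homotopy S e"
      "(loop_mult ?q ?p, loop_concat p q) \<in> loop_homotopy S e"
    by (auto intro!: loop_homotopy_cong loop_mult_in_loops loop_concat_eq_mult[OF p q])
  then show "(loop_concat p q, loop_mult p q) \<in> loop_homotopy S e"
    and "(loop_concat p q, loop_mult q p) \<in> loop_homotopy S e"
    using loop_mult_homotopy[OF hom] loop_mult_homotopy[OF hom(2,1)]
    by (blast intro: loop_homotopy_sym loop_homotopy_trans)+
qed

lemma loop_reverse_concat:
  assumes p: "p \<in> loops S e"
  shows "p \<circ> (\<lambda>t. 1 - t) \<in> loops S e"
    and "(loop_concat p (p \<circ> (\<lambda>t. 1 - t)), \<lambda>t. e) \<in> loop_homotopy S e"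
proof -
  show rev: "p \<circ> (\<lambda>t. 1 - t) \<in> loops S e"
    by (rule loop_reparametrization[OF p]) (auto intro!: continuous_intros)
  \<comment> \<open>Running along \<open>p\<close> and back is \<open>p\<close> after a tent function, which is null-homotopic in the
    interval relative to its end points.\<close>
  have "loop_concat p (p \<circ> (\<lambda>t. 1 - t)) = p \<circ> (\<lambda>t. 1 - \<bar>1 - 2 * t\<bar>)"
    by (auto simp: loop_concat_def fun_eq_iff algebra_simps abs_if)
  moreover have "(p \<circ> (\<lambda>t. 1 - \<bar>1 - 2 * t\<bar>), \<lambda>t. e) \<in> loop_homotopy S e"
    by (rule loop_homotopy_contract[OF p]) (auto intro!: continuous_intros)
  ultimately show "(loop_concat p (p \<circ> (\<lambda>t. 1 - t)), \<lambda>t. e) \<in> loop_homotopy S e"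
    by simp
qed

lemma fundamental_group_mult:
  assumes p: "p \<in> loops S e" and q: "q \<in> loops S e"
  shows "(loop_homotopy S e `` {p}) \<otimes>\<^bsub>fundamental_group S e\<^esub> (loop_homotopy S e `` {q})
    = loop_homotopy S e `` {loop_mult p q}"
proof -
  have "loop_homotopy S e `` {loop_concat p' q'} = loop_homotopy S e `` {loop_mult p q}"
    if "(p, p') \<in> loop_homotopy S e" "(q, q') \<in> loop_homotopy S e" for p' q'
  proof (rule equiv_class_eq[OF equiv_loop_homotopy])
    have "p' \<in> loops S e" "q' \<in> loops S e"
      using that by (auto simp: loop_homotopy_def)
    then show "(loop_concat p' q', loop_mult p q) \<in> loop_homotopy S e"
      using loop_mult_homotopic_concat(1) loop_mult_homotopy[OF that]
      by (blast intro: loop_homotopy_sym loop_homotopy_trans)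
  qed
  moreover have "p \<in> loop_homotopy S e `` {p}" "q \<in> loop_homotopy S e `` {q}"
    using p q by (auto intro: loop_homotopy_refl)
  ultimately show ?thesis
    by (auto simp: fundamental_group_def)
qed

text \<open>On homotopy classes the operation is that of the pointwise product, so associativity and the unit
  law hold already for loops, on the unit interval; homotopy enters only for commutativity and for inverses.\<close>

theorem comm_group_fundamental_group: "comm_group (fundamental_group S e)"
proof -
  let ?G = "fundamental_group S e" and ?cl = "\<lambda>p. loop_homotopy S e `` {p}"
  have cl_carrier: "?cl p \<in> carrier ?G" if "p \<in> loops S e" for p
    using that by (simp add: fundamental_group_def quotientI)
  have carrierE: "\<exists>p\<in>loops S e. C = ?cl p" if "C \<in> carrier ?G" for C
    using that by (auto simp: fundamental_group_def elim: quotientE)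
  have cl_eq: "?cl p = ?cl q" if "(p, q) \<in> loop_homotopy S e" for p q
    using that by (rule equiv_class_eq[OF equiv_loop_homotopy])
  have one: "\<one>\<^bsub>?G\<^esub> = ?cl (\<lambda>t. e)"
    by (simp add: fundamental_group_def)
  show ?thesis
  proof (rule comm_groupI)
    fix C D assume "C \<in> carrier ?G" "D \<in> carrier ?G"
    then obtain p q where pq: "p \<in> loops S e" "q \<in> loops S e" "C = ?cl p" "D = ?cl q"
      using carrierE by metis
    then show "C \<otimes>\<^bsub>?G\<^esub> D \<in> carrier ?G"
      by (simp add: fundamental_group_mult cl_carrier loop_mult_in_loops)
    have "(loop_mult p q, loop_mult q p) \<in> loop_homotopy S e"
      using loop_mult_homotopic_concat[OF pq(1,2)]
      by (blast intro: loop_homotopy_sym loop_homotopy_trans)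
    then show "C \<otimes>\<^bsub>?G\<^esub> D = D \<otimes>\<^bsub>?G\<^esub> C"
      using pq by (simp add: fundamental_group_mult cl_eq)
  next
    show "\<one>\<^bsub>?G\<^esub> \<in> carrier ?G"
      by (simp add: one cl_carrier const_loop)
  next
    fix C D E assume "C \<in> carrier ?G" "D \<in> carrier ?G" "E \<in> carrier ?G"
    then obtain p q r where pqr: "p \<in> loops S e" "q \<in> loops S e" "r \<in> loops S e"
        "C = ?cl p" "D = ?cl q" "E = ?cl r"
      using carrierE by metis
    have "(loop_mult (loop_mult p q) r, loop_mult p (loop_mult q r)) \<in> loop_homotopy S e"
    proof (rule loop_homotopy_cong)
      show "loop_mult (loop_mult p q) r \<in> loops S e"
        using pqr by (simp add: loop_mult_in_loops)
    qed (use pqr in \<open>simp add: loop_mult_def mult_assoc loop_in_space\<close>)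
    then show "C \<otimes>\<^bsub>?G\<^esub> D \<otimes>\<^bsub>?G\<^esub> E = C \<otimes>\<^bsub>?G\<^esub> (D \<otimes>\<^bsub>?G\<^esub> E)"
      using pqr by (simp add: fundamental_group_mult loop_mult_in_loops cl_eq)
  next
    fix C assume "C \<in> carrier ?G"
    then obtain p where p: "p \<in> loops S e" "C = ?cl p"
      using carrierE by metis
    have "(p, loop_mult (\<lambda>t. e) p) \<in> loop_homotopy S e"
      using p by (intro loop_homotopy_cong) (simp_all add: loop_mult_def left_unit loop_in_space)
    from cl_eq[OF this] show "\<one>\<^bsub>?G\<^esub> \<otimes>\<^bsub>?G\<^esub> C = C"
      unfolding p(2) one fundamental_group_mult[OF const_loop p(1)] by (rule sym)
    have "(loop_mult (p \<circ> (\<lambda>t. 1 - t)) p, \<lambda>t. e) \<in> loop_homotopy S e"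
      using loop_mult_homotopic_concat(2)[OF p(1) loop_reverse_concat(1)[OF p(1)]]
        loop_reverse_concat(2)[OF p(1)]
      by (blast intro: loop_homotopy_sym loop_homotopy_trans)
    then have "?cl (p \<circ> (\<lambda>t. 1 - t)) \<otimes>\<^bsub>?G\<^esub> C = \<one>\<^bsub>?G\<^esub>"
      using p loop_reverse_concat(1)[OF p(1)]
      by (simp add: one fundamental_group_mult cl_eq)
    then show "\<exists>D\<in>carrier ?G. D \<otimes>\<^bsub>?G\<^esub> C = \<one>\<^bsub>?G\<^esub>"
      using cl_carrier[OF loop_reverse_concat(1)[OF p(1)]] by blast
  qed
qed

end

section \<open>Composition in the compact-open topology\<close>

text \<open>An open subset of a locally compact Hausdorff space is itself locally compact Hausdorff, so compact
  neighbourhoods may be taken inside it.\<close>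

lemma compact_neighbourhood_in_open:
  assumes "locally_compact_space S" "Hausdorff_space S"
    and K: "compactin S K" and W: "openin S W" and KW: "K \<subseteq> W"
  obtains V L where "openin S V" "compactin S L" "K \<subseteq> V" "V \<subseteq> L" "L \<subseteq> W"
proof -
  have reg: "regular_space S"
    using assms by (simp add: locally_compact_Hausdorff_imp_regular_space)
  let ?W = "subtopology S W"
  have "locally_compact_space ?W" "Hausdorff_space ?W"
    using assms by (simp_all add: Hausdorff_space_subtopology locally_compact_space_open_subset reg)
  moreover have "compactin ?W K"
    using K KW by (simp add: compactin_subtopology)
  ultimately obtain V L where "openin ?W V" "compactin ?W L" "K \<subseteq> V" "V \<subseteq> L"
    using locally_compact_space_compact_closed_compact[of ?W] by blast
  then show thesis
    using W by (intro that[of V L]) (auto simp: compactin_subtopology openin_open_subtopology)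
qed

lemma openin_compact_open_subbasis:
  assumes "compactin S K" "openin T U"
  shows "openin (compact_open_topology S T) {f \<in> continuous_maps S T. f ` K \<subseteq> U}"
  unfolding compact_open_topology_def
  by (rule topology_generated_by_Basis) (use assms in blast)

lemma continuous_maps_compose:
  assumes "g \<in> continuous_maps R S" "f \<in> continuous_maps S T"
  shows "compose (topspace R) f g \<in> continuous_maps R T"
proof -
  have "continuous_map R T (f \<circ> g)"
    using assms by (auto simp: continuous_maps_def intro: continuous_map_compose)
  then have "continuous_map R T (compose (topspace R) f g)"
    by (rule continuous_map_eq) (simp add: compose_eq)
  then show ?thesis
    by (simp add: continuous_maps_def)
qed

text \<open>If \<open>f \<circ> g\<close> maps the compact set \<open>K\<close> into the open set \<open>U\<close>, then the compact set \<open>g(K)\<close> lies in the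
  open set \<open>f\<^sup>-\<^sup>1(U)\<close>. Local compactness provides room for both maps to vary at once: for
  \<open>g(K) \<subseteq> V \<subseteq> L \<subseteq> f\<^sup>-\<^sup>1(U)\<close> with \<open>V\<close> open and \<open>L\<close> compact, it suffices that \<open>g\<close> maps \<open>K\<close> into
  \<open>V\<close> and \<open>f\<close> maps \<open>L\<close> into \<open>U\<close>.\<close>

lemma continuous_map_composition:
  assumes S: "locally_compact_space S" "Hausdorff_space S"
  shows "continuous_map (prod_topology (compact_open_topology S T) (compact_open_topology R S))
    (compact_open_topology R T) (\<lambda>(f, g). compose (topspace R) f g)"
    (is "continuous_map ?P _ ?c")
proof -
  let ?B = "{{f \<in> continuous_maps R T. f ` K \<subseteq> U} | K U. compactin R K \<and> openin T U}"
  have top: "topspace ?P = continuous_maps S T \<times> continuous_maps R S"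
    by (simp add: topspace_compact_open_topology)
  have "continuous_map ?P (topology_generated_by ?B) ?c"
  proof (rule continuous_on_generated_topo)
    have "continuous_maps R T \<subseteq> \<Union>?B"
      using topspace_compact_open_topology[of R T]
      by (simp add: compact_open_topology_def topology_generated_by_topspace)
    moreover have "?c ` topspace ?P \<subseteq> continuous_maps R T"
      unfolding top by (auto intro: continuous_maps_compose)
    ultimately show "?c ` topspace ?P \<subseteq> \<Union>?B"
      by (rule order_trans[rotated])
  next
    fix N assume "N \<in> ?B"
    then obtain K U where N: "N = {f \<in> continuous_maps R T. f ` K \<subseteq> U}"
        and K: "compactin R K" and U: "openin T U"
      by blast
    have KR: "K \<subseteq> topspace R"
      using K by (rule compactin_subset_topspace)
    show "openin ?P (?c -` N \<inter> topspace ?P)"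
      unfolding openin_prod_topology_alt
    proof (intro allI impI)
      fix f g assume "(f, g) \<in> ?c -` N \<inter> topspace ?P"
      then have f: "f \<in> continuous_maps S T" and g: "g \<in> continuous_maps R S"
        and fg: "compose (topspace R) f g ` K \<subseteq> U"
        unfolding top N by auto
      define W where "W = {y \<in> topspace S. f y \<in> U}"
      have "openin S W"
        unfolding W_def using f U by (auto simp: continuous_maps_def openin_continuous_map_preimage)
      moreover have "compactin S (g ` K)"
        using g K by (auto simp: continuous_maps_def image_compactin)
      moreover have "g ` K \<subseteq> W"
      proof (rule image_subsetI)
        fix x assume x: "x \<in> K"
        then have "g x \<in> topspace S"
          using KR g by (auto simp: continuous_maps_def continuous_map_def)
        moreover have "f (g x) \<in> U"
          using fg x KR by (auto simp: compose_eq subset_iff)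
        ultimately show "g x \<in> W"
          by (simp add: W_def)
      qed
      ultimately obtain V L where VL: "openin S V" "compactin S L" "g ` K \<subseteq> V" "V \<subseteq> L" "L \<subseteq> W"
        using compact_neighbourhood_in_open[OF S] by metis
      let ?F = "{f \<in> continuous_maps S T. f ` L \<subseteq> U}"
      let ?G = "{g \<in> continuous_maps R S. g ` K \<subseteq> V}"
      have "?F \<times> ?G \<subseteq> ?c -` N \<inter> topspace ?P"
      proof clarify
        fix f' g' assume f': "f' \<in> continuous_maps S T" "f' ` L \<subseteq> U"
          and g': "g' \<in> continuous_maps R S" "g' ` K \<subseteq> V"
        have "compose (topspace R) f' g' x \<in> U" if "x \<in> K" for x
        proof -
          have "g' x \<in> L"
            using g'(2) VL(4) that by blast
          then show ?thesis
            using f'(2) KR that by (auto simp: compose_eq subset_iff)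
        qed
        then show "(f', g') \<in> ?c -` N \<inter> topspace ?P"
          using f'(1) g'(1) continuous_maps_compose[OF g'(1) f'(1)] unfolding top N by auto
      qed
      moreover have "f \<in> ?F" "g \<in> ?G"
        using f g VL by (auto simp: W_def)
      ultimately show "\<exists>F G. openin (compact_open_topology S T) F \<and>
          openin (compact_open_topology R S) G \<and> f \<in> F \<and> g \<in> G \<and>
          F \<times> G \<subseteq> ?c -` N \<inter> topspace ?P"
        using openin_compact_open_subbasis[OF VL(2) U] openin_compact_open_subbasis[OF K VL(1)]
        by blast
    qed
  qed
  then show ?thesis
    by (simp add: compact_open_topology_def[of R T])
qed

section \<open>The maximal spectrum of a pm-ring\<close>

text \<open>Zorn's lemma. With \<open>S = {\<one>}\<close> it yields maximal ideals, with a multiplicatively closed \<open>S\<close> prime ideals.\<close>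

lemma (in ring) exists_ideal_maximal_disjoint:
  assumes I: "ideal I R" "I \<inter> S = {}"
  obtains P where "ideal P R" "I \<subseteq> P" "P \<inter> S = {}"
    "\<And>J. ideal J R \<Longrightarrow> P \<subseteq> J \<Longrightarrow> J \<inter> S = {} \<Longrightarrow> J = P"
proof -
  let ?A = "{J. ideal J R \<and> I \<subseteq> J \<and> J \<inter> S = {}}"
  have "\<exists>M\<in>?A. \<forall>J\<in>?A. M \<subseteq> J \<longrightarrow> J = M"
  proof (rule subset_Zorn_nonempty)
    show "?A \<noteq> {}"
      using I by blast
  next
    fix C assume C: "C \<noteq> {}" "subset.chain ?A C"
    then have "subset.chain {J. ideal J R} C"
      by (auto simp: subset_chain_def)
    from chain_Union_is_ideal[OF this] C(1) have "ideal (\<Union>C) R"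
      by simp
    moreover have "\<And>J. J \<in> C \<Longrightarrow> I \<subseteq> J \<and> J \<inter> S = {}"
      using C(2) by (auto simp: subset_chain_def)
    ultimately show "\<Union>C \<in> ?A"
      using C(1) by blast
  qed
  then obtain M where "M \<in> ?A" "\<forall>J\<in>?A. M \<subseteq> J \<longrightarrow> J = M"
    by (rule bexE)
  then show thesis
    by (intro that[of M]) auto
qed

lemma (in cring) ideal_eq_carrier:
  assumes "ideal J R" "\<one> \<in> J"
  shows "J = carrier R"
  using assms ideal.one_imp_carrier by blast

lemma (in cring) exists_maximalideal_above:
  assumes I: "ideal I R" "\<one> \<notin> I"
  obtains M where "maximalideal M R" "I \<subseteq> M"
proof -
  obtain M where M: "ideal M R" "I \<subseteq> M" "M \<inter> {\<one>} = {}"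
      "\<And>J. ideal J R \<Longrightarrow> M \<subseteq> J \<Longrightarrow> J \<inter> {\<one>} = {} \<Longrightarrow> J = M"
    using exists_ideal_maximal_disjoint[of I "{\<one>}"] I by auto
  have "maximalideal M R"
  proof (rule maximalidealI[OF M(1)])
    show "carrier R \<noteq> M"
      using M(3) by auto
    show "J = M \<or> J = carrier R" if "ideal J R" "M \<subseteq> J" for J
      using M(4)[OF that] ideal_eq_carrier[OF that(1)] by blast
  qed
  from that[OF this M(2)] show thesis .
qed

text \<open>An ideal \<open>P\<close> that is maximal among those disjoint from \<open>S\<close> is prime: if \<open>a, b \<notin> P\<close>, both
  \<open>P + (a)\<close> and \<open>P + (b)\<close> meet \<open>S\<close>, hence so does their product, which lies in \<open>P + (a b)\<close>;
  therefore \<open>a b \<notin> P\<close>.\<close>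

lemma (in cring) exists_primeideal_disjoint:
  assumes I: "ideal I R" "I \<inter> S = {}"
    and S: "S \<subseteq> carrier R" "\<one> \<in> S" "\<And>s t. s \<in> S \<Longrightarrow> t \<in> S \<Longrightarrow> s \<otimes> t \<in> S"
  obtains P where "primeideal P R" "I \<subseteq> P" "P \<inter> S = {}"
proof -
  obtain P where P: "ideal P R" "I \<subseteq> P" "P \<inter> S = {}"
      "\<And>J. ideal J R \<Longrightarrow> P \<subseteq> J \<Longrightarrow> J \<inter> S = {} \<Longrightarrow> J = P"
    using exists_ideal_maximal_disjoint[OF I] by metis
  interpret P: ideal P R
    by (rule P(1))
  have meets: "\<exists>u\<in>P. \<exists>r\<in>carrier R. u \<oplus> r \<otimes> a \<in> S" if a: "a \<in> carrier R" "a \<notin> P" for a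
  proof -
    have ideal: "ideal (P <+>\<^bsub>R\<^esub> PIdl a) R"
      by (rule add_ideals[OF P(1) cgenideal_ideal[OF a(1)]])
    have "u \<in> P <+>\<^bsub>R\<^esub> PIdl a" if "u \<in> P" for u
    proof -
      have "u = u \<oplus> \<zero> \<otimes> a"
        using that a(1) by simp
      then show ?thesis
        using that unfolding set_add_def' cgenideal_def by blast
    qed
    moreover have "a = \<zero> \<oplus> \<one> \<otimes> a"
      using a(1) by simp
    then have "a \<in> P <+>\<^bsub>R\<^esub> PIdl a"
      unfolding set_add_def' cgenideal_def using P.zero_closed by blast
    ultimately have "(P <+>\<^bsub>R\<^esub> PIdl a) \<inter> S \<noteq> {}"
      using P(4)[OF ideal] a(2) by blast
    then show ?thesis
      unfolding set_add_def' cgenideal_def by blast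
  qed
  have "primeideal P R"
  proof (rule primeidealI[OF P(1) is_cring])
    show "carrier R \<noteq> P"
      using P(3) S by auto
  next
    fix a b assume a: "a \<in> carrier R" and b: "b \<in> carrier R" and ab: "a \<otimes> b \<in> P"
    show "a \<in> P \<or> b \<in> P"
    proof (rule ccontr)
      assume "\<not> (a \<in> P \<or> b \<in> P)"
      then obtain u r v s where u: "u \<in> P" "r \<in> carrier R" "u \<oplus> r \<otimes> a \<in> S"
          and v: "v \<in> P" "s \<in> carrier R" "v \<oplus> s \<otimes> b \<in> S"
        using meets a b by metis
      have uv: "u \<in> carrier R" "v \<in> carrier R"
        using u v by auto
      have "(u \<oplus> r \<otimes> a) \<otimes> (v \<oplus> s \<otimes> b) =
          u \<otimes> (v \<oplus> s \<otimes> b) \<oplus> ((r \<otimes> a) \<otimes> v \<oplus> (r \<otimes> s) \<otimes> (a \<otimes> b))"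
        using a b u(2) v(2) uv by algebra
      also have "\<dots> \<in> P"
      proof (intro P.a_closed)
        show "u \<otimes> (v \<oplus> s \<otimes> b) \<in> P"
          using b v(2) uv by (intro P.I_r_closed u(1)) simp
        show "(r \<otimes> a) \<otimes> v \<in> P"
          using a u(2) by (intro P.I_l_closed v(1)) simp
        show "(r \<otimes> s) \<otimes> (a \<otimes> b) \<in> P"
          using u(2) v(2) by (intro P.I_l_closed ab) simp
      qed
      finally show False
        using S(3)[OF u(3) v(3)] P(3) by blast
    qed
  qed
  with P(2,3) show thesis
    by (blast intro: that)
qed

context cring
begin

lemma Max_Spec_subset_Spec: "Max_Spec R \<subseteq> Spec R"
  by (auto simp: Max_Spec_def Spec_def maximalideal_prime)

lemma topspace_max_topology: "topspace (max_topology R) = Max_Spec R"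
  using Max_Spec_subset_Spec by (auto simp: max_topology_def topspace_zariski)

lemma one_notin_Max_Spec: "M \<in> Max_Spec R \<Longrightarrow> \<one> \<notin> M"
  using ideal_eq_carrier maximalideal.I_notcarr maximalideal.axioms(1)
  by (fastforce simp: Max_Spec_def)

lemma openin_max_topology_basic:
  assumes "a \<in> carrier R"
  shows "openin (max_topology R) {M \<in> Max_Spec R. a \<notin> M}"
proof -
  have "openin (zariski R) (Spec R - vanishing R {a})"
    unfolding openin_zariski using assms by (intro exI[of _ "{a}"]) auto
  moreover have "{M \<in> Max_Spec R. a \<notin> M} = (Spec R - vanishing R {a}) \<inter> Max_Spec R"
    using Max_Spec_subset_Spec by (auto simp: vanishing_def)
  ultimately show ?thesis
    unfolding max_topology_def openin_subtopology by blast
qed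

lemma openin_max_topology_contains_basic:
  assumes "openin (max_topology R) U" "M \<in> U"
  obtains a where "a \<in> carrier R" "a \<notin> M" "{N \<in> Max_Spec R. a \<notin> N} \<subseteq> U"
proof -
  obtain E where "E \<subseteq> carrier R" "U = (Spec R - vanishing R E) \<inter> Max_Spec R"
    using assms(1) by (auto simp: max_topology_def openin_subtopology openin_zariski)
  moreover then obtain a where "a \<in> E" "a \<notin> M"
    using assms(2) by (auto simp: vanishing_def)
  ultimately show thesis
    using Max_Spec_subset_Spec by (intro that[of a]) (auto simp: vanishing_def)
qed

text \<open>For a given cover, the elements \<open>a\<close> whose basic open set \<open>D(a)\<close> has a finite subcover form an
  ideal, because \<open>D(a + b) \<subseteq> D(a) \<union> D(b)\<close> and \<open>D(x a) \<subseteq> D(a)\<close>. No maximal ideal \<open>M\<close> contains it: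
  a member of the cover around \<open>M\<close> contains some \<open>D(a)\<close> with \<open>a \<notin> M\<close>. So the ideal contains
  \<open>\<one>\<close>, and \<open>D(\<one>)\<close> is the whole space.\<close>

lemma compact_space_max_topology: "compact_space (max_topology R)"
  unfolding compact_space_alt topspace_max_topology
proof (intro allI impI, elim conjE)
  fix \<U> assume op: "\<forall>U\<in>\<U>. openin (max_topology R) U" and cover: "Max_Spec R \<subseteq> \<Union>\<U>"
  define I where "I = {a \<in> carrier R. \<exists>\<F>. finite \<F> \<and> \<F> \<subseteq> \<U> \<and> {M \<in> Max_Spec R. a \<notin> M} \<subseteq> \<Union>\<F>}"
  have I_subset: "b \<in> I" if a: "a \<in> I" and b: "b \<in> carrier R"
      and "\<And>M. M \<in> Max_Spec R \<Longrightarrow> a \<in> M \<Longrightarrow> b \<in> M" for a b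
    using that unfolding I_def by blast
  have ideal: "ideal I R"
  proof (rule idealI[OF ring_axioms])
    show "subgroup I (add_monoid R)"
    proof (rule group.subgroupI[OF a_group])
      show "I \<subseteq> carrier (add_monoid R)"
        by (auto simp: I_def)
      have "\<zero> \<in> M" if "M \<in> Max_Spec R" for M
        using that by (simp add: Max_Spec_def additive_subgroup.zero_closed ideal.axioms(1) maximalideal.axioms(1))
      then have "\<zero> \<in> I"
        unfolding I_def by (auto intro!: exI[of _ "{}"])
      then show "I \<noteq> {}"
        by blast
    next
      fix a assume a: "a \<in> I"
      then have "a \<in> carrier R" by (simp add: I_def)
      then have "\<ominus> a \<in> I"
        by (intro I_subset[OF a])
          (auto simp: Max_Spec_def additive_subgroup.a_inv_closed ideal.axioms(1) maximalideal.axioms(1))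
      then show "inv\<^bsub>add_monoid R\<^esub> a \<in> I"
        by (simp add: a_inv_def)
    next
      fix a b assume a: "a \<in> I" and b: "b \<in> I"
      then obtain \<F> \<G> where \<F>: "finite \<F>" "\<F> \<subseteq> \<U>" "{M \<in> Max_Spec R. a \<notin> M} \<subseteq> \<Union>\<F>"
          and \<G>: "finite \<G>" "\<G> \<subseteq> \<U>" "{M \<in> Max_Spec R. b \<notin> M} \<subseteq> \<Union>\<G>"
        unfolding I_def by blast
      have "{M \<in> Max_Spec R. a \<oplus> b \<notin> M} \<subseteq> {M \<in> Max_Spec R. a \<notin> M} \<union> {M \<in> Max_Spec R. b \<notin> M}"
        by (auto simp: Max_Spec_def additive_subgroup.a_closed ideal.axioms(1) maximalideal.axioms(1))
      then have "{M \<in> Max_Spec R. a \<oplus> b \<notin> M} \<subseteq> \<Union>(\<F> \<union> \<G>)"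
        using \<F>(3) \<G>(3) by blast
      moreover have "a \<oplus> b \<in> carrier R"
        using a b by (simp add: I_def)
      ultimately show "a \<otimes>\<^bsub>add_monoid R\<^esub> b \<in> I"
        using \<F>(1,2) \<G>(1,2) unfolding I_def
        by (auto intro!: exI[of _ "\<F> \<union> \<G>"])
    qed
  next
    fix a x assume a: "a \<in> I" and x: "x \<in> carrier R"
    have "a \<in> carrier R"
      using a by (simp add: I_def)
    with x show "x \<otimes> a \<in> I" "a \<otimes> x \<in> I"
      by (auto intro!: I_subset[OF a]
          simp: Max_Spec_def ideal.I_l_closed ideal.I_r_closed maximalideal.axioms(1))
  qed
  have "\<one> \<in> I"
  proof (rule ccontr)
    assume "\<one> \<notin> I"
    then obtain M where M: "maximalideal M R" "I \<subseteq> M"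
      using exists_maximalideal_above[OF ideal] by blast
    then obtain U where U: "U \<in> \<U>" "M \<in> U"
      using cover by (auto simp: Max_Spec_def)
    then obtain a where a: "a \<in> carrier R" "a \<notin> M" "{N \<in> Max_Spec R. a \<notin> N} \<subseteq> U"
      using openin_max_topology_contains_basic op by metis
    then have "a \<in> I"
      using U(1) unfolding I_def by (auto intro!: exI[of _ "{U}"])
    with a(2) M(2) show False
      by blast
  qed
  then show "\<exists>\<F>. finite \<F> \<and> \<F> \<subseteq> \<U> \<and> Max_Spec R \<subseteq> \<Union>\<F>"
    using one_notin_Max_Spec unfolding I_def by blast
qed

end

context pm_ring
begin

text \<open>The products \<open>a b\<close> with \<open>a \<notin> M\<close> and \<open>b \<notin> N\<close> form a multiplicatively closed set. If it did not
  contain zero, some prime ideal would avoid it and hence lie in both \<open>M\<close> and \<open>N\<close>, which the pm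
  property forbids.\<close>

lemma separate_maximal_ideals:
  assumes M: "maximalideal M R" and N: "maximalideal N R" and "M \<noteq> N"
  obtains a b where "a \<in> carrier R - M" "b \<in> carrier R - N" "a \<otimes> b = \<zero>"
proof (rule ccontr)
  assume neg: "\<not> thesis"
  interpret M: primeideal M R by (rule maximalideal_prime[OF M])
  interpret N: primeideal N R by (rule maximalideal_prime[OF N])
  define S where "S = {a \<otimes> b | a b. a \<in> carrier R - M \<and> b \<in> carrier R - N}"
  have one: "\<one> \<in> carrier R - M" "\<one> \<in> carrier R - N"
    using one_notin_Max_Spec M N by (auto simp: Max_Spec_def)
  have S_I: "a \<otimes> b \<in> S" if "a \<in> carrier R - M" "b \<in> carrier R - N" for a b
    using that unfolding S_def by blast
  have "{\<zero>} \<inter> S = {}"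
    using neg that unfolding S_def by force
  moreover have "S \<subseteq> carrier R"
    by (auto simp: S_def)
  moreover have "\<one> \<in> S"
    using S_I[OF one] by simp
  moreover have "s \<otimes> t \<in> S" if st: "s \<in> S" "t \<in> S" for s t
  proof -
    obtain a b c d where *: "s = a \<otimes> b" "t = c \<otimes> d" "a \<in> carrier R - M" "c \<in> carrier R - M"
        "b \<in> carrier R - N" "d \<in> carrier R - N"
      using st unfolding S_def by blast
    then have "s \<otimes> t = (a \<otimes> c) \<otimes> (b \<otimes> d)"
      by (simp add: m_ac)
    moreover have "a \<otimes> c \<in> carrier R - M" "b \<otimes> d \<in> carrier R - N"
      using * M.I_prime N.I_prime by blast+
    ultimately show ?thesis
      using S_I by simp
  qed
  ultimately obtain P where P: "primeideal P R" "P \<inter> S = {}"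
    using exists_primeideal_disjoint[OF zeroideal] by metis
  interpret P: primeideal P R
    by (rule P(1))
  have "P \<subseteq> M"
  proof (rule subsetI, rule ccontr)
    fix x assume "x \<in> P" "x \<notin> M"
    with S_I[OF _ one(2), of x] P(2) show False
      by (auto simp: disjoint_iff)
  qed
  moreover have "P \<subseteq> N"
  proof (rule subsetI, rule ccontr)
    fix x assume "x \<in> P" "x \<notin> N"
    with S_I[OF one(1), of x] P(2) show False
      by (auto simp: disjoint_iff)
  qed
  ultimately show False
    using unique_maximal[OF P(1)] M N \<open>M \<noteq> N\<close> by blast
qed

text \<open>If \<open>a b = \<zero>\<close>, every prime ideal contains \<open>a\<close> or \<open>b\<close>, so \<open>D(a)\<close> and \<open>D(b)\<close> are disjoint.\<close>

lemma Hausdorff_space_max_topology: "Hausdorff_space (max_topology R)"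
  unfolding Hausdorff_space_def topspace_max_topology
proof (intro allI impI, elim conjE)
  fix M N assume MN: "M \<in> Max_Spec R" "N \<in> Max_Spec R" "M \<noteq> N"
  then obtain a b where ab: "a \<in> carrier R - M" "b \<in> carrier R - N" "a \<otimes> b = \<zero>"
    using separate_maximal_ideals[of M N] unfolding Max_Spec_def by blast
  have "a \<in> Q \<or> b \<in> Q" if "Q \<in> Max_Spec R" for Q
  proof -
    interpret Q: primeideal Q R
      using that by (auto simp: Max_Spec_def maximalideal_prime)
    show ?thesis
      using ab by (intro Q.I_prime) auto
  qed
  then have "disjnt {Q \<in> Max_Spec R. a \<notin> Q} {Q \<in> Max_Spec R. b \<notin> Q}"
    by (auto simp: disjnt_def)
  then show "\<exists>U V. openin (max_topology R) U \<and> openin (max_topology R) V \<and> M \<in> U \<and> N \<in> V \<and> disjnt U V"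
    using openin_max_topology_basic[of a] openin_max_topology_basic[of b] ab MN by blast
qed

lemma pm_retraction:
  assumes "primeideal P R"
  shows "pm_retraction R P \<in> Max_Spec R" "P \<subseteq> pm_retraction R P"
  using theI'[OF unique_maximal[OF assms]] by (auto simp: pm_retraction_def Max_Spec_def)

lemma pm_retraction_eqI:
  assumes "primeideal P R" "M \<in> Max_Spec R" "P \<subseteq> M"
  shows "pm_retraction R P = M"
  using assms pm_retraction[OF assms(1)] unique_maximal[OF assms(1)] by (auto simp: Max_Spec_def)

lemma primeideal_preimage:
  assumes "f \<in> ring_hom R R" "M \<in> Max_Spec R"
  shows "primeideal {x \<in> carrier R. f x \<in> M} R"
proof -
  interpret ring_hom_ring R R f
    by (rule ring_hom_ringI2[OF ring_axioms ring_axioms assms(1)])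
  show ?thesis
    using assms(2) by (intro primeideal_vimage is_cring) (simp add: Max_Spec_def maximalideal_prime)
qed

lemma spectral_map_in_Max_Spec:
  assumes "f \<in> ring_hom R R" "M \<in> Max_Spec R"
  shows "spectral_map R f M \<in> Max_Spec R" "{x \<in> carrier R. f x \<in> M} \<subseteq> spectral_map R f M"
  using pm_retraction[OF primeideal_preimage[OF assms]] assms(2) by (auto simp: spectral_map_def)

text \<open>Contravariant functoriality. The retraction to maximal ideals in the middle does no harm: it
  only enlarges \<open>g\<^sup>-\<^sup>1(M)\<close>, so the maximal ideal \<open>\<mu>\<^sub>f(\<mu>\<^sub>g(M))\<close> still contains the prime
  \<open>(g \<circ> f)\<^sup>-\<^sup>1(M)\<close>, and uniqueness applies.\<close>

lemma spectral_map_compose: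
  assumes f: "f \<in> ring_hom R R" and g: "g \<in> ring_hom R R"
  shows "spectral_map R (g \<circ> f) = compose (Max_Spec R) (spectral_map R f) (spectral_map R g)"
proof (rule extensionalityI)
  fix M assume M: "M \<in> Max_Spec R"
  let ?N = "spectral_map R g M"
  have N: "?N \<in> Max_Spec R" "{x \<in> carrier R. g x \<in> M} \<subseteq> ?N"
    by (rule spectral_map_in_Max_Spec[OF g M])+
  have "{x \<in> carrier R. (g \<circ> f) x \<in> M} \<subseteq> {x \<in> carrier R. f x \<in> ?N}"
    using N(2) ring_hom_closed[OF f] by auto
  also have "\<dots> \<subseteq> spectral_map R f ?N"
    by (rule spectral_map_in_Max_Spec[OF f N(1)])
  finally have "pm_retraction R {x \<in> carrier R. (g \<circ> f) x \<in> M} = spectral_map R f ?N"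
    by (intro pm_retraction_eqI primeideal_preimage ring_hom_trans[OF f g] M
        spectral_map_in_Max_Spec[OF f N(1)])
  then show "spectral_map R (g \<circ> f) M = compose (Max_Spec R) (spectral_map R f) (spectral_map R g) M"
    using M by (simp add: spectral_map_def[of R "g \<circ> f"] compose_eq)
qed (auto simp: spectral_map_def)

lemma spectral_map_id: "spectral_map R (\<lambda>x. x) = (\<lambda>M\<in>Max_Spec R. M)"
proof -
  have "pm_retraction R {x \<in> carrier R. x \<in> M} = M" if M: "M \<in> Max_Spec R" for M
    by (rule pm_retraction_eqI[OF primeideal_preimage[OF _ M] M]) (auto intro: ring_hom_memI)
  then show ?thesis
    unfolding spectral_map_def by (intro restrict_ext)
qed

end

section \<open>The spectral fundamental group\<close>

lemma algebra_endomorphisms_id: "(\<lambda>x. x) \<in> algebra_endomorphisms K A"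
  by (auto simp: algebra_endomorphisms_def intro: ring_hom_memI)

lemma algebra_endomorphisms_comp:
  assumes "f \<in> algebra_endomorphisms K A" "g \<in> algebra_endomorphisms K A"
  shows "g \<circ> f \<in> algebra_endomorphisms K A"
  using assms ring_hom_trans[of f A A g A]
  by (auto simp: algebra_endomorphisms_def ring_hom_closed)

text \<open>The points of the space are the continuous maps that are spectral; each of the two properties
  passes to compositions, the second by \<open>spectral_map_compose\<close>.\<close>

lemma topological_monoid_spectral_space:
  fixes A :: "('k, 'a, 'b) module_scheme"
  assumes "pm_ring A"
  shows "topological_monoid (spectral_space K A) (compose (Max_Spec A)) (spectral_map A (\<lambda>x. x))"
proof -
  interpret pm_ring A by (rule assms)
  let ?T = "max_topology A" and ?E = "algebra_endomorphisms K A"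
  let ?C = "compact_open_topology ?T ?T"
  have space: "topspace (spectral_space K A) = continuous_maps ?T ?T \<inter> spectral_map A ` ?E"
    by (simp add: spectral_space_def topspace_compact_open_topology)
  have maps: "f \<in> extensional (Max_Spec A)" "f \<in> Max_Spec A \<rightarrow> Max_Spec A"
    if "f \<in> topspace (spectral_space K A)" for f
    using that unfolding space
    by (auto simp: continuous_maps_def topspace_max_topology continuous_map_def)
  have closed: "compose (Max_Spec A) f g \<in> spectral_map A ` ?E"
    if fg: "f \<in> spectral_map A ` ?E" "g \<in> spectral_map A ` ?E" for f g
  proof -
    obtain f' g' where *: "f = spectral_map A f'" "g = spectral_map A g'" "f' \<in> ?E" "g' \<in> ?E"
      using fg by blast
    then have "compose (Max_Spec A) f g = spectral_map A (g' \<circ> f')"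
      by (simp add: spectral_map_compose algebra_endomorphisms_def)
    then show ?thesis
      using algebra_endomorphisms_comp * by blast
  qed
  show ?thesis
  proof
    have "continuous_map ?T ?T (\<lambda>M\<in>Max_Spec A. M)"
      by (rule continuous_map_eq[OF continuous_map_id]) (simp add: topspace_max_topology)
    then show "spectral_map A (\<lambda>x. x) \<in> topspace (spectral_space K A)"
      unfolding space using imageI[OF algebra_endomorphisms_id[of K A], of "spectral_map A"]
      by (simp add: spectral_map_id continuous_maps_def topspace_max_topology)
  next
    have "locally_compact_space ?T" "Hausdorff_space ?T"
      by (simp_all add: Hausdorff_space_max_topology compact_imp_locally_compact_space
          compact_space_max_topology)
    then have "continuous_map (prod_topology ?C ?C) ?C (\<lambda>(f, g). compose (Max_Spec A) f g)"
      using continuous_map_composition[of ?T ?T ?T] by (simp add: topspace_max_topology)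
    then show "continuous_map (prod_topology (spectral_space K A) (spectral_space K A))
        (spectral_space K A) (\<lambda>(f, g). compose (Max_Spec A) f g)"
      using closed unfolding spectral_space_def prod_topology_subtopology
      by (auto simp: continuous_map_in_subtopology intro!: continuous_map_from_subtopology)
  next
    fix f g h
    assume "h \<in> topspace (spectral_space K A)"
    then show "compose (Max_Spec A) (compose (Max_Spec A) f g) h
        = compose (Max_Spec A) f (compose (Max_Spec A) g h)"
      using maps(2) compose_assoc by metis
  next
    fix f assume f: "f \<in> topspace (spectral_space K A)"
    show "compose (Max_Spec A) (spectral_map A (\<lambda>x. x)) f = f"
      unfolding spectral_map_id by (rule Id_compose[OF maps(2)[OF f] maps(1)[OF f]])
    show "compose (Max_Spec A) f (spectral_map A (\<lambda>x. x)) = f"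
      unfolding spectral_map_id by (rule FuncSet.compose_Id[OF maps(2)[OF f] maps(1)[OF f]])
  qed
qed

lemma comm_group_spectral_fundamental_group:
  assumes "pm_ring A"
  shows "comm_group (spectral_fundamental_group K A)"
  unfolding spectral_fundamental_group_def
  by (rule topological_monoid.comm_group_fundamental_group[OF topological_monoid_spectral_space[OF assms]])

theorem theorem4p1:
  fixes A :: "(int, 'a, 'b) module_scheme" and B :: "(real, 'c, 'd) module_scheme"
  shows "(Module.algebra (ring_of_type_algebra :: int ring) A \<and> pm_ring A \<longrightarrow>
            comm_group (spectral_fundamental_group (ring_of_type_algebra :: int ring) A)) \<and>
         (Module.algebra (ring_of_type_algebra :: real ring) B \<and> pm_ring B \<longrightarrow>
            comm_group (spectral_fundamental_group (ring_of_type_algebra :: real ring) B))"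
  by (simp add: comm_group_spectral_fundamental_group)

end
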